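(* Let $\{X_t^{(\lambda)}\}_{\lambda\in\mathbb{R}^+}$ be a $\lambda$-parametrized family of stochastic processes on $[0,T]$ started at $0$ at time $0$ and having transition probability density $$Q^{(\lambda)}(x,t\,|\,0,0)=e^{-\lambda t}\,\frac{h^{(\lambda)}(x)}{h^{(\lambda)}(0)}\,q(x,t\,|\,0,0),$$ with $q$, $h^{(\lambda)}$ as in the context, and suppose that $R^{(\lambda)}(x):=\frac{\partial}{\partial\lambda}h^{(\lambda)}(x)$ satisfies $R^{(\lambda)}(x)=R^{(\lambda)}(-x)\ge0$ for all $x\in\mathbb{R}$. Let $\lambda_1<\lambda_2$. Then a risk-averse agent with time-consistent and time-invariant preferences favors $X^{(\lambda_1)}$ over $X^{(\lambda_2)}$: for every utility function $u(x,t)$ of such an agent, i.e. with $u_{xx}\le 0$, $$\mathbb{E}\left[u\big(X_t^{(\lambda_1)},t\big)\right]\ \ge\ \mathbb{E}\left[u\big(X_t^{(\lambda_2)},t\big)\right]\qquad\text{for all }t\in[0,T].$$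
   Context: Base diffusion: $dX_t=b(X_t)\,dt+\sigma\,dW_t$ on $[0,T]$, where $W$ is a standard Brownian motion, $\sigma\in\mathbb{R}$, and $b:\mathbb{R}\to\mathbb{R}$ is at least $\mathcal{C}^2$ with bounded first and second derivatives and is odd: $b(x)=-b(-x)$. Its transition probability density is $q(x,t\,|\,x_0,s)$; by symmetry $q(x,t\,|\,0,0)=q(-x,t\,|\,0,0)$. Its diffusion operator is $\mathcal{L}_x\varphi=\frac{\sigma^2}{2}\varphi''+b\,\varphi'$. For each $\lambda\in\mathbb{R}^+$, $h^{(\lambda)}:\mathbb{R}\to\mathbb{R}$ is a nonnegative even function (with $h^{(\lambda)}(0)>0$), differentiable in $\lambda$, with $\mathcal{L}_x h^{(\lambda)}=\lambda h^{(\lambda)}$. The process $e^{-\lambda t}h^{(\lambda)}(X_t)/h^{(\lambda)}(0)$ is a martingale with expectation $1$ (for the base diffusion started at $0$), so that $Q^{(\lambda)}(\cdot,t\,|\,0,0)$ is a normalized probability density. Time-invariant and time-consistent preferences: writing $\sim_t$ for the agent's indifference relation, decided at time $t$, between dated payments, for all $x_1,x_2\in\mathbb{R}$, $\Delta_1,\Delta_2\in\mathbb{R}^+$ and $t,t'\in[0,T]$, $$u(x_1,t+\Delta_1)\sim_t u(x_2,t+\Delta_2)\iff u(x_1,t'+\Delta_1)\sim_{t'}u(x_2,t'+\Delta_2),$$ $$u(x_1,t+\Delta_1)\sim_t u(x_2,t+\Delta_2)\iff u(x_1,t+\Delta_1)\sim_{t'}u(x_2,t+\Delta_2).$$ *)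

theory Defs
  imports "HOL-Probability.Probability"
begin

definition C2_bounded_derivatives :: "(real \<Rightarrow> real) \<Rightarrow> bool" where
  "C2_bounded_derivatives b \<longleftrightarrow>
     (\<exists>b' b''. (\<forall>x. (b has_real_derivative b' x) (at x)) \<and>
               (\<forall>x. (b' has_real_derivative b'' x) (at x)) \<and>
               continuous_on UNIV b'' \<and> bounded (range b') \<and> bounded (range b''))"

definition filtration_on :: "'a measure \<Rightarrow> real \<Rightarrow> (real \<Rightarrow> 'a measure) \<Rightarrow> bool" where
  "filtration_on M T F \<longleftrightarrow>
     (\<forall>t\<in>{0..T}. subalgebra M (F t)) \<and>
     (\<forall>s t. 0 \<le> s \<and> s \<le> t \<and> t \<le> T \<longrightarrow> subalgebra (F t) (F s))"

definition brownian_motion_on ::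
  "'a measure \<Rightarrow> (real \<Rightarrow> 'a measure) \<Rightarrow> real \<Rightarrow> (real \<Rightarrow> 'a \<Rightarrow> real) \<Rightarrow> bool" where
  "brownian_motion_on M F T W \<longleftrightarrow>
     prob_space M \<and> filtration_on M T F \<and>
     (\<forall>t\<in>{0..T}. W t \<in> borel_measurable (F t)) \<and>
     (AE \<omega> in M. W 0 \<omega> = 0) \<and>
     (AE \<omega> in M. continuous_on {0..T} (\<lambda>t. W t \<omega>)) \<and>
     (\<forall>s t. 0 \<le> s \<and> s < t \<and> t \<le> T \<longrightarrow>
        distributed M lborel (\<lambda>\<omega>. W t \<omega> - W s \<omega>)
          (\<lambda>x. ennreal (normal_density 0 (sqrt (t - s)) x)) \<and>
        prob_space.indep_set M (sets (F s))
          (sets (vimage_algebra (space M) (\<lambda>\<omega>. W t \<omega> - W s \<omega>) borel)))"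

text \<open>
  The equation \<open>dX = b(X) dt + \<sigma> dW\<close> on \<open>[s, T]\<close> with \<open>X = x0\<close> at time \<open>s\<close>.  Since the
  diffusion coefficient is constant, the stochastic integral of \<open>\<sigma>\<close> over \<open>[s, t]\<close> is
  \<open>\<sigma> (W t - W s)\<close>, and the integral form of the equation makes sense path by path.
\<close>
definition sde_solution ::
  "'a measure \<Rightarrow> (real \<Rightarrow> 'a measure) \<Rightarrow> real \<Rightarrow> (real \<Rightarrow> real) \<Rightarrow> real \<Rightarrow>
   (real \<Rightarrow> 'a \<Rightarrow> real) \<Rightarrow> real \<Rightarrow> real \<Rightarrow> (real \<Rightarrow> 'a \<Rightarrow> real) \<Rightarrow> bool" where
  "sde_solution M F T b \<sigma> W s x0 X \<longleftrightarrow>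
     (\<forall>t\<in>{s..T}. X t \<in> borel_measurable (F t)) \<and>
     (AE \<omega> in M. continuous_on {s..T} (\<lambda>t. X t \<omega>) \<and>
        (\<forall>t\<in>{s..T}. X t \<omega> =
           x0 + integral {s..t} (\<lambda>r. b (X r \<omega>)) + \<sigma> * (W t \<omega> - W s \<omega>)))"

text \<open>
  In \<open>X s x0 t\<close> the process is started at the point \<open>x0\<close> at time \<open>s\<close> and observed at time \<open>t\<close>;
  \<open>q x t x0 s\<close> is the density written \<open>q(x, t | x0, s)\<close>.  There is no density at \<open>t = s\<close>,
  where the law is a point mass.
\<close>
definition transition_density ::
  "'a measure \<Rightarrow> real \<Rightarrow> (real \<Rightarrow> real \<Rightarrow> real \<Rightarrow> 'a \<Rightarrow> real) \<Rightarrow>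
   (real \<Rightarrow> real \<Rightarrow> real \<Rightarrow> real \<Rightarrow> real) \<Rightarrow> bool" where
  "transition_density M T X q \<longleftrightarrow>
     (\<forall>s x0 t. 0 \<le> s \<and> s < t \<and> t \<le> T \<longrightarrow>
        (\<forall>x. 0 \<le> q x t x0 s) \<and>
        distributed M lborel (X s x0 t) (\<lambda>x. ennreal (q x t x0 s)))"

definition diffusion_operator ::
  "(real \<Rightarrow> real) \<Rightarrow> real \<Rightarrow> (real \<Rightarrow> real) \<Rightarrow> real \<Rightarrow> real" where
  "diffusion_operator b \<sigma> \<phi> x = \<sigma>\<^sup>2 / 2 * deriv (deriv \<phi>) x + b x * deriv \<phi> x"

definition twice_differentiable :: "(real \<Rightarrow> real) \<Rightarrow> bool" where
  "twice_differentiable f \<longleftrightarrow>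
     (\<forall>x. f differentiable (at x)) \<and> (\<forall>x. deriv f differentiable (at x))"

definition martingale_on ::
  "'a measure \<Rightarrow> (real \<Rightarrow> 'a measure) \<Rightarrow> real \<Rightarrow> (real \<Rightarrow> 'a \<Rightarrow> real) \<Rightarrow> bool" where
  "martingale_on M F T Z \<longleftrightarrow>
     (\<forall>t\<in>{0..T}. Z t \<in> borel_measurable (F t) \<and> integrable M (Z t)) \<and>
     (\<forall>s t. 0 \<le> s \<and> s \<le> t \<and> t \<le> T \<longrightarrow>
        (AE \<omega> in M. real_cond_exp M (F s) (Z t) \<omega> = Z s \<omega>))"

text \<open>The density \<open>Q(x, t | 0, 0)\<close> with parameter \<open>l\<close>.\<close>
definition tilted_density ::
  "(real \<Rightarrow> real \<Rightarrow> real) \<Rightarrow> (real \<Rightarrow> real \<Rightarrow> real \<Rightarrow> real \<Rightarrow> real) \<Rightarrow>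
   real \<Rightarrow> real \<Rightarrow> real \<Rightarrow> real" where
  "tilted_density h q l x t = exp (- l * t) * (h l x / h l 0) * q x t 0 0"

definition process_from_0_with_density ::
  "'b measure \<Rightarrow> real \<Rightarrow> (real \<Rightarrow> 'b \<Rightarrow> real) \<Rightarrow> (real \<Rightarrow> real \<Rightarrow> real) \<Rightarrow> bool" where
  "process_from_0_with_density P T Y f \<longleftrightarrow>
     prob_space P \<and>
     (\<forall>t\<in>{0..T}. Y t \<in> borel_measurable P) \<and>
     (AE \<omega> in P. Y 0 \<omega> = 0) \<and>
     (\<forall>t\<in>{0<..T}. distributed P lborel (Y t) (\<lambda>x. ennreal (f x t)))"

text \<open>
  \<open>indiff t\<close> is the indifference relation decided at time \<open>t\<close>.  It relates dated payments: the
  payment \<open>x\<close> received at date \<open>s\<close> enters as \<open>(u x s, s)\<close>, its utility together with its date.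
\<close>
definition time_invariant ::
  "real \<Rightarrow> (real \<Rightarrow> real \<times> real \<Rightarrow> real \<times> real \<Rightarrow> bool) \<Rightarrow> (real \<Rightarrow> real \<Rightarrow> real) \<Rightarrow> bool" where
  "time_invariant T indiff u \<longleftrightarrow>
     (\<forall>x1 x2 \<Delta>1 \<Delta>2 t t'. 0 < \<Delta>1 \<and> 0 < \<Delta>2 \<and> t \<in> {0..T} \<and> t' \<in> {0..T} \<longrightarrow>
        (indiff t (u x1 (t + \<Delta>1), t + \<Delta>1) (u x2 (t + \<Delta>2), t + \<Delta>2) \<longleftrightarrow>
         indiff t' (u x1 (t' + \<Delta>1), t' + \<Delta>1) (u x2 (t' + \<Delta>2), t' + \<Delta>2)))"

definition time_consistent ::
  "real \<Rightarrow> (real \<Rightarrow> real \<times> real \<Rightarrow> real \<times> real \<Rightarrow> bool) \<Rightarrow> (real \<Rightarrow> real \<Rightarrow> real) \<Rightarrow> bool" where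
  "time_consistent T indiff u \<longleftrightarrow>
     (\<forall>x1 x2 \<Delta>1 \<Delta>2 t t'. 0 < \<Delta>1 \<and> 0 < \<Delta>2 \<and> t \<in> {0..T} \<and> t' \<in> {0..T} \<longrightarrow>
        (indiff t (u x1 (t + \<Delta>1), t + \<Delta>1) (u x2 (t + \<Delta>2), t + \<Delta>2) \<longleftrightarrow>
         indiff t' (u x1 (t + \<Delta>1), t + \<Delta>1) (u x2 (t + \<Delta>2), t + \<Delta>2)))"

definition risk_averse :: "real \<Rightarrow> (real \<Rightarrow> real \<Rightarrow> real) \<Rightarrow> bool" where
  "risk_averse T u \<longleftrightarrow>
     (\<forall>t\<in>{0..T}. twice_differentiable (\<lambda>x. u x t) \<and> (\<forall>x. deriv (deriv (\<lambda>x. u x t)) x \<le> 0))"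

text \<open>
  A concave utility may have expectation \<open>-\<infinity>\<close>, whereas the Bochner integral of a
  non-integrable function is \<open>0\<close>; hence the expectation is taken in the extended reals, as the
  difference of the integrals of the positive and the negative part.
\<close>
definition ext_expectation :: "'b measure \<Rightarrow> ('b \<Rightarrow> real) \<Rightarrow> ereal" where
  "ext_expectation P Z =
     enn2ereal (\<integral>\<^sup>+\<omega>. ennreal (Z \<omega>) \<partial>P) - enn2ereal (\<integral>\<^sup>+\<omega>. ennreal (- Z \<omega>) \<partial>P)"

lemma ext_expectation_eq_integral:
  assumes "integrable P Z"
  shows "ext_expectation P Z = ereal (integral\<^sup>L P Z)"
proof -
  have "(\<integral>\<^sup>+\<omega>. ennreal (Z \<omega>) \<partial>P) \<noteq> \<infinity>" "(\<integral>\<^sup>+\<omega>. ennreal (- Z \<omega>) \<partial>P) \<noteq> \<infinity>"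
    using assms by (auto simp: real_integrable_def)
  then obtain r s where rs: "0 \<le> r" "(\<integral>\<^sup>+\<omega>. ennreal (Z \<omega>) \<partial>P) = ennreal r"
      "0 \<le> s" "(\<integral>\<^sup>+\<omega>. ennreal (- Z \<omega>) \<partial>P) = ennreal s"
    by (metis ennreal_cases infinity_ennreal_def)
  then show ?thesis
    unfolding ext_expectation_def real_lebesgue_integral_def[OF assms]
    by (simp add: enn2ereal_ennreal)
qed

end

theory Submission imports Defs begin

text \<open>
  At a fixed time \<open>t > 0\<close> the two laws have densities \<open>f\<^sub>i = c\<^sub>i h\<^sub>i m\<close>, where \<open>m\<close> is the density of
  the base diffusion and \<open>h\<^sub>i\<close> the eigenfunction for \<open>\<lambda>\<^sub>i\<close>.  Both are even, and the quotient
  \<open>h\<^sub>2 / h\<^sub>1\<close> is nondecreasing in \<open>\<bar>x\<bar>\<close>: the Wronskian \<open>w = h\<^sub>1 h\<^sub>2' - h\<^sub>1' h\<^sub>2\<close> vanishes at 0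
  and satisfies \<open>\<sigma>\<^sup>2/2 w' + b w = (\<lambda>\<^sub>2 - \<lambda>\<^sub>1) h\<^sub>1 h\<^sub>2 \<ge> 0\<close>, hence \<open>w \<ge> 0\<close> on the positive half line
  (\<open>eigenfunction_ratio_nondecreasing\<close>).  So \<open>f\<^sub>2 - f\<^sub>1\<close>, whose integral is 0, changes sign once as
  \<open>\<bar>x\<bar>\<close> grows, from minus to plus: the second law is the first one with mass moved outwards
  symmetrically.  A concave \<open>g\<close> enters only through its symmetrization \<open>k x = g x + g (- x)\<close>, which
  decreases in \<open>\<bar>x\<bar>\<close>; with the crossing point \<open>r\<close> the integrand \<open>(k x - k r) (f\<^sub>2 x - f\<^sub>1 x)\<close> is
  everywhere \<open>\<le> 0\<close> and has the same integral as \<open>2 g (f\<^sub>2 - f\<^sub>1)\<close>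
  (\<open>even_single_crossing_concave\<close>).

  Two facts about the processes have to be supplied.  First, \<open>m\<close> is even almost everywhere.  The Euler
  scheme for an odd drift, started at 0, is an odd function of independent symmetric increments, so
  its law is symmetric; for constant \<open>\<sigma>\<close> the scheme converges path by path to the diffusion, and
  characteristic functions carry the symmetry to the limit
  (\<open>odd_drift_diffusion_symmetric\<close>).

  Second, the second law has a finite first moment, without which a linear utility would have the
  expectation \<open>\<infinity> - \<infinity>\<close> (\<open>eigenfunction_weighted_dominated\<close>).  The function \<open>(1 + x\<^sup>2) h\<^sub>2\<close> is a
  subsolution of the eigenvalue equation for a larger eigenvalue \<open>\<lambda>\<^sub>3\<close>, because \<open>h\<^sub>2' / h\<^sub>2\<close> grows at
  most linearly; by the Wronskian argument again it is bounded by a multiple of \<open>h\<^sub>3\<close>, and \<open>h\<^sub>3 m\<close>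
  is integrable since the process with parameter \<open>\<lambda>\<^sub>3\<close> has a density proportional to it.
\<close>

section \<open>Even eigenfunctions of a one-dimensional diffusion operator\<close>

text \<open>
  Multiplying by the integrating factor \<open>exp C\<close>, with \<open>C' = c\<close>, makes \<open>y\<close> nondecreasing.
\<close>
lemma linear_diff_ineq_nonneg:
  fixes y y' c :: "real \<Rightarrow> real"
  assumes deriv: "\<And>s. 0 \<le> s \<Longrightarrow> (y has_real_derivative y' s) (at s)"
    and ineq: "\<And>s. 0 \<le> s \<Longrightarrow> 0 \<le> y' s + c s * y s"
    and c: "continuous_on UNIV c" and y0: "0 \<le> y 0" and x: "0 \<le> x"
  shows "0 \<le> y x"
proof -
  \<comment> \<open>The lower limit -1 puts 0 in the interior, so that \<open>C\<close> has a two-sided derivative there.\<close>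
  define C where "C s = integral {-1..s} c" for s
  have C: "(C has_real_derivative c s) (at s)" if "0 \<le> s" for s
  proof -
    have "(C has_real_derivative c s) (at s within {-1..s+1})"
      unfolding C_def using that c
      by (intro integral_has_real_derivative) (auto intro: continuous_on_subset)
    then show ?thesis
      using that by (simp add: at_within_Icc_at)
  qed
  have "exp (C 0) * y 0 \<le> exp (C x) * y x"
  proof (rule DERIV_nonneg_imp_nondecreasing[OF x])
    fix s assume s: "0 \<le> s" "s \<le> x"
    have "((\<lambda>s. exp (C s) * y s) has_real_derivative exp (C s) * (y' s + c s * y s)) (at s)"
      using C[OF s(1)] deriv[OF s(1)]
      by (auto intro!: derivative_eq_intros simp: algebra_simps)
    then show "\<exists>d. ((\<lambda>s. exp (C s) * y s) has_real_derivative d) (at s) \<and> 0 \<le> d"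
      using ineq[OF s(1)] by (auto intro!: exI)
  qed
  moreover have "0 \<le> exp (C 0) * y 0"
    using y0 by simp
  ultimately have "0 \<le> exp (C x) * y x"
    by linarith
  then show ?thesis
    by (simp add: zero_le_mult_iff)
qed

text \<open>
  Sturm comparison for the operator \<open>k y'' + b y'\<close>: the Wronskian \<open>w = f g' - f' g\<close> satisfies
  \<open>k w' + b w = f (k g'' + b g') - g (k f'' + b f')\<close>, hence stays nonnegative once it starts at 0, and
  \<open>w / f\<^sup>2\<close> is the derivative of \<open>g / f\<close>.  The operator hypothesis is an inequality, not a pair of
  equations, so that the lemma also applies to constants and to subsolutions.
\<close>
lemma ratio_nondecreasing:
  fixes f f' f'' g g' g'' b :: "real \<Rightarrow> real"
  assumes f: "\<And>s. (f has_real_derivative f' s) (at s)" "\<And>s. (f' has_real_derivative f'' s) (at s)"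
    and g: "\<And>s. (g has_real_derivative g' s) (at s)" "\<And>s. (g' has_real_derivative g'' s) (at s)"
    and k: "0 < k" and b: "continuous_on UNIV b"
    and zero: "f' 0 = 0" "g' 0 = 0" and pos: "\<And>s. 0 \<le> s \<Longrightarrow> 0 < f s"
    and gen: "\<And>s. 0 \<le> s \<Longrightarrow> g s * (k * f'' s + b s * f' s) \<le> f s * (k * g'' s + b s * g' s)"
    and xy: "0 \<le> x" "x \<le> y"
  shows "f' x * g x \<le> f x * g' x" and "g x / f x \<le> g y / f y"
proof -
  have w: "0 \<le> f s * g' s - f' s * g s" if s: "0 \<le> s" for s
  proof (rule linear_diff_ineq_nonneg[where c = "\<lambda>s. b s / k"
        and y = "\<lambda>s. f s * g' s - f' s * g s"])
    show "((\<lambda>s. f s * g' s - f' s * g s) has_real_derivative f s * g'' s - f'' s * g s) (at s)" for s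
      using f[of s] g[of s] by (auto intro!: derivative_eq_intros)
    show "0 \<le> (f s * g'' s - f'' s * g s) + b s / k * (f s * g' s - f' s * g s)"
      if "0 \<le> s" for s
    proof -
      have "0 \<le> (f s * (k * g'' s + b s * g' s) - g s * (k * f'' s + b s * f' s)) / k"
        using gen[OF that] k by simp
      also have "\<dots> = (f s * g'' s - f'' s * g s) + b s / k * (f s * g' s - f' s * g s)"
        using k by (simp add: field_simps)
      finally show ?thesis .
    qed
    show "continuous_on UNIV (\<lambda>s. b s / k)"
      using b k by (auto intro!: continuous_intros)
  qed (use zero s in auto)
  from w[OF xy(1)] show "f' x * g x \<le> f x * g' x"
    by simp
  show "g x / f x \<le> g y / f y"
  proof (rule DERIV_nonneg_imp_nondecreasing[OF xy(2)])
    fix s assume "x \<le> s" "s \<le> y"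
    then have s: "0 \<le> s" using xy by simp
    have "((\<lambda>s. g s / f s) has_real_derivative (f s * g' s - f' s * g s) / (f s)\<^sup>2) (at s)"
      using f(1)[of s] g(1)[of s] pos[OF s]
      by (auto intro!: derivative_eq_intros simp: power2_eq_square mult.commute)
    then show "\<exists>d. ((\<lambda>s. g s / f s) has_real_derivative d) (at s) \<and> 0 \<le> d"
      using w[OF s] by (auto intro!: exI)
  qed
qed

text \<open>
  \<open>k\<close> stands for \<open>\<sigma>\<^sup>2 / 2\<close>.  The derivatives are arguments so that comparison functions built from
  \<open>h\<close>, such as \<open>(1 + x\<^sup>2) h\<close>, have explicit derivatives.
\<close>
definition even_eigenfunction where
  "even_eigenfunction k b l h h' h'' \<longleftrightarrow>
     (\<forall>x. (h has_real_derivative h' x) (at x)) \<and> (\<forall>x. (h' has_real_derivative h'' x) (at x)) \<and>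
     (\<forall>x. k * h'' x + b x * h' x = l * h x) \<and>
     (\<forall>x. h (- x) = h x) \<and> (\<forall>x. 0 \<le> h x) \<and> 0 < h (0::real) \<and> 0 < (l::real)"

lemma even_deriv_0:
  fixes h :: "real \<Rightarrow> real"
  assumes "(h has_real_derivative d) (at 0)" "\<And>x. h (- x) = h x"
  shows "d = 0"
proof -
  have "((\<lambda>x. h (- x)) has_real_derivative d * (- 1)) (at 0)"
    using assms(1) by (intro DERIV_chain2[where f = h]) (auto intro!: derivative_eq_intros)
  then have "(h has_real_derivative - d) (at 0)"
    by (simp add: assms(2))
  with assms(1) have "d = - d"
    by (rule DERIV_unique)
  then show ?thesis by simp
qed

context
  fixes k L :: real and b :: "real \<Rightarrow> real"
  assumes k: "0 < k" and b: "continuous_on UNIV b" and L: "\<And>x. \<bar>b x\<bar> \<le> L * \<bar>x\<bar>"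
begin

text \<open>
  A nonnegative eigenfunction is a subsolution of the equation with eigenvalue 0, so it can be
  compared with the constant 1.  In particular it has no zeros.
\<close>
lemma eigenfunction_increasing:
  assumes h: "even_eigenfunction k b l h h' h''" and x: "0 \<le> x"
  shows "0 \<le> h' x" and "0 < h x" and "h' 0 = 0"
proof -
  show h'0: "h' 0 = 0"
    using h even_deriv_0[of h "h' 0"] unfolding even_eigenfunction_def by blast
  have *: "(\<lambda>_. 0) s * h s \<le> (\<lambda>_. 1) s * h' s" "h 0 / (\<lambda>_. 1) 0 \<le> h s / (\<lambda>_. 1) s"
    if s: "0 \<le> s" for s
    using ratio_nondecreasing[where f = "\<lambda>_. 1" and f' = "\<lambda>_. 0" and f'' = "\<lambda>_. 0"
        and g = h and g' = h' and g'' = h'' and k = k and b = b and x = s and y = s]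
      ratio_nondecreasing[where f = "\<lambda>_. 1" and f' = "\<lambda>_. 0" and f'' = "\<lambda>_. 0"
        and g = h and g' = h' and g'' = h'' and k = k and b = b and x = 0 and y = s]
      h h'0 s k b unfolding even_eigenfunction_def by auto
  from *[OF x] show "0 \<le> h' x" "0 < h x"
    using h unfolding even_eigenfunction_def by auto
qed

lemma eigenfunction_ratio_nondecreasing:
  assumes h1: "even_eigenfunction k b l1 h1 h1' h1''" and h2: "even_eigenfunction k b l2 h2 h2' h2''"
    and l: "l1 \<le> l2" and xy: "0 \<le> x" "x \<le> y"
  shows "h2 x / h1 x \<le> h2 y / h1 y"
proof (rule ratio_nondecreasing[where f' = h1' and f'' = h1'' and g' = h2' and g'' = h2''
      and k = k and b = b])
  fix s :: real assume "0 \<le> s"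
  have "l1 * (h1 s * h2 s) \<le> l2 * (h1 s * h2 s)"
    using h1 h2 l unfolding even_eigenfunction_def by (intro mult_right_mono) auto
  then show "h2 s * (k * h1'' s + b s * h1' s) \<le> h1 s * (k * h2'' s + b s * h2' s)"
    using h1 h2 unfolding even_eigenfunction_def by (simp add: ac_simps)
qed (use h1 h2 xy k b eigenfunction_increasing[OF h1] eigenfunction_increasing[OF h2] in
    \<open>auto simp: even_eigenfunction_def\<close>)

text \<open>
  The logarithmic derivative \<open>v = h' / h\<close> solves the Riccati equation \<open>v' = l/k - (b/k) v - v\<^sup>2\<close>, and
  \<open>A + B x\<close> with \<open>A\<^sup>2 = l/k\<close> and \<open>B = L/k\<close> is a supersolution of it that starts above \<open>v 0 = 0\<close>.
  Stated for \<open>h'\<close> itself, this becomes a linear differential inequality for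
  \<open>(A + B x) h - h'\<close>.
\<close>
lemma eigenfunction_log_derivative_bound:
  assumes h: "even_eigenfunction k b l h h' h''" and x: "0 \<le> x"
  shows "h' x \<le> (sqrt (l / k) + L / k * x) * h x"
proof -
  define A B where "A = sqrt (l / k)" and "B = L / k"
  have l: "0 < l" and pos: "\<And>s. 0 \<le> h s"
    and ode: "\<And>s. k * h'' s + b s * h' s = l * h s"
    and d: "\<And>s. (h has_real_derivative h' s) (at s)" "\<And>s. (h' has_real_derivative h'' s) (at s)"
    using h unfolding even_eigenfunction_def by auto
  have A: "0 \<le> A" "A * A = l / k"
    using l k unfolding A_def by auto
  have "0 \<le> L" using L[of 1] by simp
  then have B: "0 \<le> B" using k unfolding B_def by simp
  have "0 \<le> (A + B * x) * h x - h' x"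
  proof (rule linear_diff_ineq_nonneg[where c = "\<lambda>_. A"
        and y = "\<lambda>s. (A + B * s) * h s - h' s"])
    show "((\<lambda>s. (A + B * s) * h s - h' s) has_real_derivative
        B * h s + (A + B * s) * h' s - h'' s) (at s)" for s
      using d[of s] by (auto intro!: derivative_eq_intros simp: algebra_simps)
    show "0 \<le> B * h s + (A + B * s) * h' s - h'' s + A * ((A + B * s) * h s - h' s)"
      if s: "0 \<le> s" for s
    proof -
      have h'': "h'' s = A * A * h s - b s / k * h' s"
        using ode[of s] k unfolding A by (simp add: field_simps)
      have "- (b s / k) \<le> B * s"
        using L[of s] s k unfolding B_def by (simp add: field_simps)
      then have "0 \<le> (B * s + b s / k) * h' s"
        using eigenfunction_increasing(1)[OF h s] by simp
      moreover have "0 \<le> B * h s + A * B * s * h s"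
        using A B s pos[of s] by simp
      ultimately show ?thesis
        unfolding h'' by (simp add: algebra_simps)
    qed
    show "0 \<le> (A + B * 0) * h 0 - h' 0"
      using eigenfunction_increasing(3)[OF h x] A pos[of 0] by simp
  qed (use x in auto)
  then show ?thesis
    unfolding A_def B_def by simp
qed

text \<open>
  Raising the eigenvalue buys polynomial growth.  Applying the operator to \<open>f = (1 + x\<^sup>2) h\<close> produces,
  besides \<open>l f\<close>, the terms \<open>2 k h\<close>, \<open>4 k x h'\<close> and \<open>2 x b h\<close>; by the linear bounds on \<open>h' / h\<close> and \<open>b\<close>
  each is at most a constant times \<open>f\<close>, and \<open>m - l\<close> is the sum of these constants.  So \<open>f\<close> is a
  subsolution for the eigenvalue \<open>m\<close>, and \<open>g / f\<close> is nondecreasing on the positive half line.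
\<close>
lemma eigenfunction_weighted_dominated:
  assumes h: "even_eigenfunction k b l h h' h''"
    and g: "even_eigenfunction k b m g g' g''"
    and m: "m = l + 2 * k + 4 * k * (sqrt (l / k) + L / k) + 2 * L"
  shows "(1 + x\<^sup>2) * h x \<le> h 0 / g 0 * g x"
proof -
  define A B where "A = sqrt (l / k)" and "B = L / k"
  define f f' f'' where "f s = (1 + s\<^sup>2) * h s" and "f' s = 2 * s * h s + (1 + s\<^sup>2) * h' s"
    and "f'' s = 2 * h s + 4 * s * h' s + (1 + s\<^sup>2) * h'' s" for s
  have l: "0 < l" and pos: "\<And>s. 0 \<le> h s" "\<And>s. 0 \<le> g s"
    and ode: "\<And>s. k * h'' s + b s * h' s = l * h s" "\<And>s. k * g'' s + b s * g' s = m * g s"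
    and d: "\<And>s. (h has_real_derivative h' s) (at s)" "\<And>s. (h' has_real_derivative h'' s) (at s)"
      "\<And>s. (g has_real_derivative g' s) (at s)" "\<And>s. (g' has_real_derivative g'' s) (at s)"
    using h g unfolding even_eigenfunction_def by auto
  have L0: "0 \<le> L" using L[of 1] by simp
  have A: "0 \<le> A" and B: "0 \<le> B" using l L0 k unfolding A_def B_def by auto
  have *: "(1 + x\<^sup>2) * h x \<le> h 0 / g 0 * g x" if x: "0 \<le> x" for x
  proof -
    have "g 0 / f 0 \<le> g x / f x"
    proof (rule ratio_nondecreasing[where f' = f' and f'' = f'' and g' = g' and g'' = g''
          and k = k and b = b])
      show "(f has_real_derivative f' s) (at s)" for s
        unfolding f_def[abs_def] f'_def using d[of s]
        by (auto intro!: derivative_eq_intros simp: algebra_simps)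
      show "(f' has_real_derivative f'' s) (at s)" for s
        unfolding f'_def[abs_def] f''_def using d[of s]
        by (auto intro!: derivative_eq_intros simp: algebra_simps)
      show "0 < f s" if "0 \<le> s" for s
        unfolding f_def using eigenfunction_increasing(2)[OF h that] by (simp add: add_pos_nonneg)
      show "g s * (k * f'' s + b s * f' s) \<le> f s * (k * g'' s + b s * g' s)" if s: "0 \<le> s" for s
      proof -
        have s1: "s \<le> 1 + s\<^sup>2"
          using zero_le_power2[of "s - 1/2"] by (simp add: power2_eq_square algebra_simps)
        have "s * h' s \<le> s * ((A + B * s) * h s)"
          using eigenfunction_log_derivative_bound[OF h s] s unfolding A_def B_def
          by (intro mult_left_mono)
        also have "\<dots> = (A * s + B * s\<^sup>2) * h s"
          by (simp add: algebra_simps power2_eq_square)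
        also have "\<dots> \<le> (A * (1 + s\<^sup>2) + B * (1 + s\<^sup>2)) * h s"
          using s1 A B pos(1)[of s] by (intro mult_right_mono add_mono mult_left_mono) auto
        finally have "4 * k * (s * h' s) \<le> 4 * k * ((A + B) * (1 + s\<^sup>2) * h s)"
          using k by (intro mult_left_mono) (auto simp: algebra_simps)
        moreover have "2 * k * h s \<le> 2 * k * ((1 + s\<^sup>2) * h s)"
          using k pos(1)[of s] by (intro mult_left_mono) (auto simp: algebra_simps)
        moreover have "2 * (s * b s) * h s \<le> 2 * (L * (1 + s\<^sup>2)) * h s"
        proof -
          have "s * b s \<le> s * (L * s)"
            using L[of s] s by (intro mult_left_mono) auto
          also have "\<dots> \<le> L * (1 + s\<^sup>2)"
            using L0 by (simp add: power2_eq_square algebra_simps)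
          finally show ?thesis
            using pos(1)[of s] by (intro mult_right_mono) auto
        qed
        moreover have "k * f'' s + b s * f' s = 2 * k * h s + 4 * k * (s * h' s)
            + 2 * (s * b s) * h s + (1 + s\<^sup>2) * (k * h'' s + b s * h' s)"
          unfolding f''_def f'_def by (simp add: algebra_simps)
        ultimately have "k * f'' s + b s * f' s \<le> m * f s"
          unfolding ode m f_def A_def[symmetric] B_def[symmetric] by (simp add: algebra_simps)
        then have "g s * (k * f'' s + b s * f' s) \<le> g s * (m * f s)"
          using pos(2) by (rule mult_left_mono)
        then show ?thesis
          unfolding ode by (simp add: ac_simps)
      qed
    qed (use d k b x eigenfunction_increasing(3)[OF h] eigenfunction_increasing(3)[OF g] in
        \<open>auto simp: f'_def\<close>)
    moreover have "0 < f 0" "0 < f x" "0 < g 0"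
      using eigenfunction_increasing(2)[OF h] eigenfunction_increasing(2)[OF g] x
      unfolding f_def by (auto simp: add_pos_nonneg)
    ultimately have "f x \<le> f 0 / g 0 * g x"
      by (simp add: field_simps)
    then show ?thesis
      unfolding f_def by simp
  qed
  have even: "h (- x) = h x" "g (- x) = g x"
    using h g unfolding even_eigenfunction_def by auto
  show ?thesis
    using *[of x] *[of "- x"] even by (cases "0 \<le> x") auto
qed

end

section \<open>Symmetry of a diffusion with odd drift\<close>

fun euler_scheme ::
  "(real \<Rightarrow> real) \<Rightarrow> real \<Rightarrow> real \<Rightarrow> (real \<Rightarrow> real) \<Rightarrow> nat \<Rightarrow> real" where
  "euler_scheme b \<sigma> d w 0 = 0"
| "euler_scheme b \<sigma> d w (Suc k) =
     euler_scheme b \<sigma> d w k + b (euler_scheme b \<sigma> d w k) * d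
       + \<sigma> * (w (real (Suc k) * d) - w (real k * d))"

text \<open>
  The noise is additive, so the scheme and the exact path receive the same noise increments and differ
  only through the drift.  On one step the drift is evaluated at a point that is off by at most the
  current error plus the oscillation \<open>e\<close> of \<open>x\<close>; the bound solves the recursion
  \<open>a\<^bsub>k+1\<^esub> = (1 + L d) a\<^bsub>k\<^esub> + L d e\<close>, \<open>a\<^bsub>0\<^esub> = 0\<close>.
\<close>
lemma euler_scheme_error:
  fixes b x w :: "real \<Rightarrow> real"
  assumes lip: "\<And>u v. \<bar>b u - b v\<bar> \<le> L * \<bar>u - v\<bar>" and bcont: "continuous_on UNIV b"
    and cont: "continuous_on {0..t} x"
    and eq: "\<And>r. r \<in> {0..t} \<Longrightarrow> x r = integral {0..r} (\<lambda>r. b (x r)) + \<sigma> * (w r - w 0)"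
    and osc: "\<And>r s. r \<in> {0..t} \<Longrightarrow> s \<in> {0..t} \<Longrightarrow> \<bar>r - s\<bar> \<le> d \<Longrightarrow> \<bar>x r - x s\<bar> \<le> e"
    and d: "0 \<le> d" and k: "real k * d \<le> t"
  shows "\<bar>euler_scheme b \<sigma> d w k - x (real k * d)\<bar> \<le> e * ((1 + L * d) ^ k - 1)"
  using k
proof (induction k)
  case 0
  have "0 \<in> {0..t}" using 0 by simp
  then show ?case using eq[of 0] by simp
next
  case (Suc k)
  define r s E where "r = real k * d" and "s = real (Suc k) * d" and "E = euler_scheme b \<sigma> d w k"
  have rs: "0 \<le> r" "s = r + d" "s \<le> t"
    using d Suc.prems unfolding r_def s_def by (auto simp: algebra_simps)
  have IH: "\<bar>E - x r\<bar> \<le> e * ((1 + L * d) ^ k - 1)"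
    unfolding E_def r_def using rs d by (intro Suc.IH) (simp add: r_def)
  have bx: "continuous_on {0..t} (\<lambda>r. b (x r))"
    using continuous_on_compose2[OF bcont cont] by simp
  have "integral {0..r} (\<lambda>r. b (x r)) + integral {r..s} (\<lambda>r. b (x r)) = integral {0..s} (\<lambda>r. b (x r))"
    using rs d bx
    by (intro Henstock_Kurzweil_Integration.integral_combine integrable_continuous_real)
      (auto intro: continuous_on_subset)
  then have step: "x s = x r + integral {r..s} (\<lambda>r. b (x r)) + \<sigma> * (w s - w r)"
    using eq[of r] eq[of s] rs d by (auto simp: algebra_simps)
  have L: "0 \<le> L"
    using lip[of 1 0] by simp
  have "norm (integral {r..s} (\<lambda>v. b E - b (x v))) \<le> L * (\<bar>E - x r\<bar> + e) * (s - r)"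
  proof (rule integral_bound)
    show "continuous_on {r..s} (\<lambda>v. b E - b (x v))"
      using bx rs by (intro continuous_intros) (auto intro: continuous_on_subset)
    fix v assume v: "v \<in> {r..s}"
    have "\<bar>E - x v\<bar> \<le> \<bar>E - x r\<bar> + e"
      using osc[of r v] v rs by auto
    then have "L * \<bar>E - x v\<bar> \<le> L * (\<bar>E - x r\<bar> + e)"
      using L by (intro mult_left_mono)
    then show "norm (b E - b (x v)) \<le> L * (\<bar>E - x r\<bar> + e)"
      using lip[of E "x v"] by simp
  qed (use rs d in auto)
  moreover have "integral {r..s} (\<lambda>v. b E - b (x v)) = b E * d - integral {r..s} (\<lambda>v. b (x v))"
    using rs d bx
    by (subst Henstock_Kurzweil_Integration.integral_diff)
      (auto intro!: integrable_continuous_real intro: continuous_on_subset)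
  ultimately have "\<bar>b E * d - integral {r..s} (\<lambda>v. b (x v))\<bar> \<le> L * (\<bar>E - x r\<bar> + e) * d"
    using rs by simp
  then have "\<bar>E + b E * d + \<sigma> * (w s - w r) - x s\<bar> \<le> \<bar>E - x r\<bar> + L * (\<bar>E - x r\<bar> + e) * d"
    unfolding step by linarith
  also have "\<dots> = \<bar>E - x r\<bar> * (1 + L * d) + L * d * e"
    by (simp add: algebra_simps)
  also have "\<dots> \<le> e * ((1 + L * d) ^ k - 1) * (1 + L * d) + L * d * e"
    using IH L d by (intro add_right_mono mult_right_mono) auto
  also have "\<dots> = e * ((1 + L * d) ^ Suc k - 1)"
    by (simp add: algebra_simps)
  finally show ?case
    unfolding r_def s_def E_def by simp
qed

text \<open>
  Uniform continuity of the path makes the oscillation over one step tend to 0, while the factor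
  \<open>(1 + L t / n)\<^sup>n\<close> stays below \<open>exp (L t)\<close>.
\<close>
lemma euler_scheme_tendsto:
  fixes b x w :: "real \<Rightarrow> real"
  assumes lip: "\<And>u v. \<bar>b u - b v\<bar> \<le> L * \<bar>u - v\<bar>" and bcont: "continuous_on UNIV b"
    and cont: "continuous_on {0..t} x"
    and eq: "\<And>r. r \<in> {0..t} \<Longrightarrow> x r = integral {0..r} (\<lambda>r. b (x r)) + \<sigma> * (w r - w 0)"
    and t: "0 \<le> t"
  shows "(\<lambda>n. euler_scheme b \<sigma> (t / real (Suc n)) w (Suc n)) \<longlonglongrightarrow> x t"
proof (rule LIMSEQ_I)
  fix \<epsilon> :: real assume \<epsilon>: "0 < \<epsilon>"
  \<comment> \<open>The factor 2 makes the final inequality strict.\<close>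
  define e where "e = \<epsilon> / (2 * exp (L * t))"
  have e: "0 < e" using \<epsilon> unfolding e_def by simp
  have L: "0 \<le> L" using lip[of 1 0] by simp
  have "uniformly_continuous_on {0..t} x"
    using cont by (intro compact_uniformly_continuous) auto
  then obtain \<delta> where \<delta>: "0 < \<delta>" "\<And>r s. r \<in> {0..t} \<Longrightarrow> s \<in> {0..t} \<Longrightarrow> \<bar>r - s\<bar> < \<delta> \<Longrightarrow> \<bar>x r - x s\<bar> < e"
    using e unfolding uniformly_continuous_on_def dist_real_def by metis
  obtain N where N: "t / \<delta> < real N"
    using reals_Archimedean2 by blast
  show "\<exists>no. \<forall>n\<ge>no. norm (euler_scheme b \<sigma> (t / real (Suc n)) w (Suc n) - x t) < \<epsilon>"
  proof (intro exI allI impI)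
    fix n assume n: "N \<le> n"
    define d where "d = t / real (Suc n)"
    have "t / \<delta> < real (Suc n)" using N n by simp
    then have d: "0 \<le> d" "d < \<delta>" "real (Suc n) * d = t"
      using t \<delta>(1) unfolding d_def by (auto simp: field_simps)
    have "\<bar>euler_scheme b \<sigma> d w (Suc n) - x (real (Suc n) * d)\<bar> \<le> e * ((1 + L * d) ^ Suc n - 1)"
      by (rule euler_scheme_error[OF lip bcont cont eq]) (use d \<delta> in \<open>fastforce\<close>)+
    also have "\<dots> \<le> e * exp (L * t)"
    proof -
      have "(1 + L * d) ^ Suc n \<le> exp (L * d) ^ Suc n"
        using L d(1) by (intro power_mono exp_ge_add_one_self) auto
      also have "\<dots> = exp (L * t)"
        using d(3) by (metis exp_of_nat_mult mult.left_commute)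
      finally show ?thesis using e by simp
    qed
    also have "\<dots> < \<epsilon>"
      using \<epsilon> unfolding e_def by simp
    finally show "norm (euler_scheme b \<sigma> (t / real (Suc n)) w (Suc n) - x t) < \<epsilon>"
      unfolding d(3) d_def[symmetric] by simp
  qed
qed

lemma (in prob_space) symmetric_sum:
  assumes ind: "indep_var borel X borel (Y :: 'a \<Rightarrow> real)"
    and X: "distr M borel X = distr M borel (\<lambda>\<omega>. - X \<omega>)"
    and Y: "distr M borel Y = distr M borel (\<lambda>\<omega>. - Y \<omega>)"
  shows "distr M borel (\<lambda>\<omega>. X \<omega> + Y \<omega>) = distr M borel (\<lambda>\<omega>. - (X \<omega> + Y \<omega>))"
proof -
  have [measurable]: "X \<in> borel_measurable M" "Y \<in> borel_measurable M"
    using ind unfolding indep_var_eq by auto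
  have "indep_var borel (uminus \<circ> X) borel (uminus \<circ> Y)"
    by (rule indep_var_compose[OF ind]) auto
  then have "distr M borel (\<lambda>\<omega>. (- X \<omega>) + (- Y \<omega>))
      = convolution (distr M borel (\<lambda>\<omega>. - X \<omega>)) (distr M borel (\<lambda>\<omega>. - Y \<omega>))"
    by (intro sum_indep_random_variable) (auto simp: comp_def)
  also have "\<dots> = distr M borel (\<lambda>\<omega>. X \<omega> + Y \<omega>)"
    unfolding X[symmetric] Y[symmetric] by (rule sum_indep_random_variable[symmetric, OF ind]) auto
  finally show ?thesis
    by (simp add: algebra_simps)
qed

lemma (in prob_space) symmetric_odd_image:
  fixes f :: "real \<Rightarrow> real"
  assumes X: "distr M borel X = distr M borel (\<lambda>\<omega>. - X \<omega>)"
    and [measurable]: "X \<in> borel_measurable M" "f \<in> borel_measurable borel"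
    and odd: "\<And>x. f (- x) = - f x"
  shows "distr M borel (\<lambda>\<omega>. f (X \<omega>)) = distr M borel (\<lambda>\<omega>. - f (X \<omega>))"
proof -
  have "distr M borel (\<lambda>\<omega>. f (X \<omega>)) = distr (distr M borel X) borel f"
    by (simp add: distr_distr comp_def)
  also have "\<dots> = distr M borel (\<lambda>\<omega>. - f (X \<omega>))"
    unfolding X by (simp add: distr_distr comp_def odd)
  finally show ?thesis .
qed

text \<open>
  The characteristic functions of \<open>X n\<close> and \<open>- X n\<close> agree, and by dominated convergence they converge
  to those of \<open>Z\<close> and \<open>- Z\<close>.
\<close>
lemma (in prob_space) symmetric_limit:
  fixes X :: "nat \<Rightarrow> 'a \<Rightarrow> real"
  assumes meas [measurable]: "\<And>n. X n \<in> borel_measurable M" "Z \<in> borel_measurable M"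
    and sym: "\<And>n. distr M borel (X n) = distr M borel (\<lambda>\<omega>. - X n \<omega>)"
    and lim: "AE \<omega> in M. (\<lambda>n. X n \<omega>) \<longlonglongrightarrow> Z \<omega>"
  shows "distr M borel Z = distr M borel (\<lambda>\<omega>. - Z \<omega>)"
proof (rule Levy_uniqueness)
  have *: "(\<lambda>n. char (distr M borel (\<lambda>\<omega>. c * X n \<omega>)) s) \<longlonglongrightarrow> char (distr M borel (\<lambda>\<omega>. c * Z \<omega>)) s"
    for c s :: real
  proof -
    have "(\<lambda>n. \<integral>\<omega>. iexp (s * (c * X n \<omega>)) \<partial>M) \<longlonglongrightarrow> (\<integral>\<omega>. iexp (s * (c * Z \<omega>)) \<partial>M)"
    proof (rule integral_dominated_convergence[where w = "\<lambda>_. 1"])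
      show "AE \<omega> in M. (\<lambda>n. iexp (s * (c * X n \<omega>))) \<longlonglongrightarrow> iexp (s * (c * Z \<omega>))"
        using lim by eventually_elim (intro tendsto_intros)
    qed auto
    then show ?thesis
      unfolding char_def by (simp add: integral_distr)
  qed
  show "char (distr M borel Z) = char (distr M borel (\<lambda>\<omega>. - Z \<omega>))"
  proof
    fix s
    show "char (distr M borel Z) s = char (distr M borel (\<lambda>\<omega>. - Z \<omega>)) s"
      using *[of 1 s] *[of "-1" s] sym by (auto intro: LIMSEQ_unique)
  qed
qed (auto intro!: real_distribution_distr)

text \<open>
  The definition of Brownian motion gives independence of the increment from the sigma-algebra
  \<open>F s\<close>, which contains the one generated by \<open>Z\<close>.
\<close>
lemma brownian_increment_indep:
  assumes W: "brownian_motion_on M F T W" and st: "0 \<le> s" "s < t" "t \<le> T"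
    and Z: "Z \<in> borel_measurable (F s)"
  shows "prob_space.indep_var M borel Z borel (\<lambda>\<omega>. W t \<omega> - W s \<omega>)"
proof -
  interpret prob_space M
    using W unfolding brownian_motion_on_def by simp
  have sub: "subalgebra M (F s)"
    using W st unfolding brownian_motion_on_def filtration_on_def by auto
  have dist: "distributed M lborel (\<lambda>\<omega>. W t \<omega> - W s \<omega>)
          (\<lambda>x. ennreal (normal_density 0 (sqrt (t - s)) x))"
    and ind: "indep_set (sets (F s))
          (sets (vimage_algebra (space M) (\<lambda>\<omega>. W t \<omega> - W s \<omega>) borel))"
    using W st unfolding brownian_motion_on_def by auto
  have "(\<lambda>\<omega>. W t \<omega> - W s \<omega>) \<in> borel_measurable M"
    using distributed_measurable[OF dist] by simp
  moreover have "Z \<in> borel_measurable M"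
    using measurable_from_subalg[OF sub Z] .
  moreover have Zs: "sigma_sets (space M) {Z -` A \<inter> space M | A. A \<in> sets borel} \<subseteq> sets (F s)"
  proof -
    have sp: "space (F s) = space M"
      using sub unfolding subalgebra_def by simp
    have "{Z -` A \<inter> space (F s) | A. A \<in> sets borel} \<subseteq> sets (F s)"
      using measurable_sets[OF Z] by blast
    then have "sigma_sets (space (F s)) {Z -` A \<inter> space (F s) | A. A \<in> sets borel} \<subseteq> sets (F s)"
      by (rule sets.sigma_sets_subset)
    then show ?thesis
      unfolding sp .
  qed
  moreover have "indep_set (sigma_sets (space M) {Z -` A \<inter> space M | A. A \<in> sets borel})
      (sigma_sets (space M) {(\<lambda>\<omega>. W t \<omega> - W s \<omega>) -` A \<inter> space M | A. A \<in> sets borel})"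
    using ind unfolding indep_set_def sets_vimage_algebra
    by (rule indep_sets_mono_sets) (simp add: Zs split: bool.split)
  ultimately show ?thesis
    unfolding indep_var_eq by blast
qed

lemma distributed_uminus:
  assumes X: "distributed M lborel X f" and [measurable]: "f \<in> borel_measurable borel"
  shows "distributed M lborel (\<lambda>\<omega>. - X \<omega>) (\<lambda>x::real. f (- x))"
proof -
  have m [measurable]: "X \<in> borel_measurable M"
    using distributed_measurable[OF X] by simp
  have "distr M borel (\<lambda>\<omega>. - X \<omega>) = distr (distr M lborel X) borel uminus"
    by (subst distr_distr) (auto simp: comp_def)
  also have "\<dots> = distr (density lborel (\<lambda>x. f (- (- x)))) borel uminus"
    unfolding distributed_distr_eq_density[OF X] by simp
  also have "\<dots> = density (distr lborel borel uminus) (\<lambda>x. f (- x))"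
    by (rule density_distr[symmetric]) auto
  also have "\<dots> = density lborel (\<lambda>x. f (- x))"
    by (simp add: lborel_distr_uminus)
  finally have "distr M borel (\<lambda>\<omega>. - X \<omega>) = density lborel (\<lambda>x. f (- x))" .
  moreover have "distr M lborel (\<lambda>\<omega>. - X \<omega>) = distr M borel (\<lambda>\<omega>. - X \<omega>)"
    by (rule distr_cong) auto
  ultimately show ?thesis
    unfolding distributed_def by auto
qed

lemma (in prob_space) symmetric_law_even_density:
  assumes X: "distributed M lborel X f" and f: "f \<in> borel_measurable borel"
    and sym: "distr M borel X = distr M borel (\<lambda>\<omega>. - X \<omega>)"
  shows "AE x :: real in lborel. f x = f (- x)"
proof -
  have "distr M lborel X = distr M lborel (\<lambda>\<omega>. - X \<omega>)"
    using sym distr_cong[of M M borel lborel X X]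
      distr_cong[of M M borel lborel "\<lambda>\<omega>. - X \<omega>" "\<lambda>\<omega>. - X \<omega>"] by simp
  then have "distributed M lborel X (\<lambda>x. f (- x))"
    using X distributed_uminus[OF X f] unfolding distributed_def by simp
  then show ?thesis
    by (rule distributed_unique[OF X])
qed

lemma distributed_even_density_symmetric:
  fixes X :: "'a \<Rightarrow> real"
  assumes X: "distributed M lborel X f" and "f \<in> borel_measurable borel" "\<And>x. f (- x) = f x"
  shows "distr M borel X = distr M borel (\<lambda>\<omega>. - X \<omega>)"
proof -
  have "distr M borel X = distr M lborel X" "distr M borel (\<lambda>\<omega>. - X \<omega>) = distr M lborel (\<lambda>\<omega>. - X \<omega>)"
    by (auto intro: distr_cong)
  then show ?thesis
    using distributed_distr_eq_density[OF X] assms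
      distributed_distr_eq_density[OF distributed_uminus[OF X assms(2)]] by simp
qed

text \<open>
  One step maps \<open>E\<close> to \<open>f E + \<sigma> D\<close> with the odd function \<open>f x = x + b x d\<close> and a centred Gaussian
  \<open>D\<close> independent of the past, so symmetry is inherited.  Measurability is part of the induction
  because independence needs \<open>E\<close> to be known at the start of the step.
\<close>
lemma euler_scheme_measurable_symmetric:
  fixes \<sigma> d :: real
  assumes W: "brownian_motion_on M F T W"
    and b [measurable]: "b \<in> borel_measurable borel" and b_odd: "\<And>x. b (- x) = - b x"
    and d: "0 < d" and k: "real k * d \<le> T"
  defines "E \<equiv> \<lambda>k \<omega>. euler_scheme b \<sigma> d (\<lambda>s. W s \<omega>) k"
  shows "E k \<in> borel_measurable (F (real k * d)) \<and>
    distr M borel (E k) = distr M borel (\<lambda>\<omega>. - E k \<omega>)"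
  using k
proof (induction k)
  case 0
  then show ?case by (simp add: E_def)
next
  case (Suc k)
  interpret prob_space M
    using W unfolding brownian_motion_on_def by simp
  define r s where "r = real k * d" and "s = real (Suc k) * d"
  have rs: "0 \<le> r" "r < s" "s \<le> T"
    using d Suc.prems unfolding r_def s_def by (auto simp: algebra_simps)
  have IH: "E k \<in> borel_measurable (F r)" "distr M borel (E k) = distr M borel (\<lambda>\<omega>. - E k \<omega>)"
    using Suc.IH rs unfolding r_def by auto
  have sub: "subalgebra (F s) (F r)" "subalgebra M (F r)" "subalgebra M (F s)"
    and Wm: "\<And>v. v \<in> {0..T} \<Longrightarrow> W v \<in> borel_measurable (F v)"
    and Wd: "distributed M lborel (\<lambda>\<omega>. W s \<omega> - W r \<omega>)
          (\<lambda>x. ennreal (normal_density 0 (sqrt (s - r)) x))"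
    using W rs unfolding brownian_motion_on_def filtration_on_def by auto
  define f where "f x = x + b x * d" for x
  have fm [measurable]: "f \<in> borel_measurable borel"
    unfolding f_def[abs_def] by measurable
  define D where "D = (\<lambda>\<omega>. W s \<omega> - W r \<omega>)"
  have E: "E (Suc k) = (\<lambda>\<omega>. f (E k \<omega>) + \<sigma> * D \<omega>)"
    by (simp add: E_def f_def D_def r_def s_def)
  have Es: "E k \<in> borel_measurable (F s)" and Em: "E k \<in> borel_measurable M"
    using measurable_from_subalg[OF sub(1) IH(1)] measurable_from_subalg[OF sub(2) IH(1)] by auto
  have [measurable]: "W r \<in> borel_measurable (F s)" "W s \<in> borel_measurable (F s)"
    using measurable_from_subalg[OF sub(1) Wm[of r]] Wm[of s] rs by auto
  have Dm: "D \<in> borel_measurable (F s)"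
    unfolding D_def by measurable
  have "E (Suc k) \<in> borel_measurable (F s)"
    unfolding E using Es Dm by measurable
  moreover have "distr M borel (E (Suc k)) = distr M borel (\<lambda>\<omega>. - E (Suc k) \<omega>)"
    unfolding E
  proof (rule symmetric_sum)
    have "indep_var borel (f \<circ> E k) borel ((*) \<sigma> \<circ> D)"
      using brownian_increment_indep[OF W rs IH(1)] unfolding D_def[symmetric]
      by (rule indep_var_compose) auto
    then show "indep_var borel (\<lambda>\<omega>. f (E k \<omega>)) borel (\<lambda>\<omega>. \<sigma> * D \<omega>)"
      by (simp add: comp_def)
    show "distr M borel (\<lambda>\<omega>. f (E k \<omega>)) = distr M borel (\<lambda>\<omega>. - f (E k \<omega>))"
      using IH(2) Em by (rule symmetric_odd_image) (auto simp: f_def b_odd)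
    have "distr M borel D = distr M borel (\<lambda>\<omega>. - D \<omega>)"
      using Wd unfolding D_def[symmetric]
      by (rule distributed_even_density_symmetric) (auto simp: normal_density_def)
    then show "distr M borel (\<lambda>\<omega>. \<sigma> * D \<omega>) = distr M borel (\<lambda>\<omega>. - (\<sigma> * D \<omega>))"
      using measurable_from_subalg[OF sub(3) Dm] by (rule symmetric_odd_image) auto
  qed
  ultimately show ?case
    unfolding s_def by blast
qed

lemma odd_drift_diffusion_symmetric:
  assumes W: "brownian_motion_on M F T W" and X: "sde_solution M F T b \<sigma> W 0 0 X"
    and lip: "\<And>u v. \<bar>b u - b v\<bar> \<le> L * \<bar>u - v\<bar>" and bcont: "continuous_on UNIV b"
    and b_odd: "\<And>x. b (- x) = - b x" and t: "0 < t" "t \<le> T"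
  shows "distr M borel (X t) = distr M borel (\<lambda>\<omega>. - X t \<omega>)"
proof -
  interpret prob_space M
    using W unfolding brownian_motion_on_def by simp
  define E where "E n \<omega> = euler_scheme b \<sigma> (t / real (Suc n)) (\<lambda>s. W s \<omega>) (Suc n)" for n \<omega>
  have sub: "subalgebra M (F t)"
    using W t unfolding brownian_motion_on_def filtration_on_def by auto
  have "E n \<in> borel_measurable (F (real (Suc n) * (t / real (Suc n)))) \<and>
    distr M borel (E n) = distr M borel (\<lambda>\<omega>. - E n \<omega>)" for n
    unfolding E_def[abs_def]
    using t b_odd borel_measurable_continuous_onI[OF bcont]
    by (intro euler_scheme_measurable_symmetric[OF W]) (auto simp del: of_nat_Suc)
  then have E: "E n \<in> borel_measurable (F t)" "distr M borel (E n) = distr M borel (\<lambda>\<omega>. - E n \<omega>)" for n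
    by (simp_all del: of_nat_Suc)
  show ?thesis
  proof (rule symmetric_limit[of E])
    show "E n \<in> borel_measurable M" for n
      using measurable_from_subalg[OF sub E(1)] .
    show "X t \<in> borel_measurable M"
      using X t unfolding sde_solution_def by (intro measurable_from_subalg[OF sub]) auto
    have "AE \<omega> in M. continuous_on {0..T} (\<lambda>t. X t \<omega>) \<and>
        (\<forall>t\<in>{0..T}. X t \<omega> = 0 + integral {0..t} (\<lambda>r. b (X r \<omega>)) + \<sigma> * (W t \<omega> - W 0 \<omega>))"
      using X unfolding sde_solution_def by auto
    then show "AE \<omega> in M. (\<lambda>n. E n \<omega>) \<longlonglongrightarrow> X t \<omega>"
    proof eventually_elim
      case (elim \<omega>)
      show ?case
        unfolding E_def using elim t
        by (intro euler_scheme_tendsto[OF lip bcont]) (auto intro: continuous_on_subset)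
    qed
  qed (rule E(2))
qed

section \<open>Single crossing of even densities and concave functions\<close>

text \<open>
  The weight is even only almost everywhere, as densities are determined only up to null sets.
\<close>
lemma integral_even_weight_reflect:
  fixes f g :: "real \<Rightarrow> real"
  assumes f: "AE x in lborel. f (- x) = f x"
    and [measurable]: "f \<in> borel_measurable borel" "g \<in> borel_measurable borel"
    and int: "integrable lborel (\<lambda>x. g x * f x)"
  shows "integrable lborel (\<lambda>x. g (- x) * f x)"
    and "(\<integral>x. g (- x) * f x \<partial>lborel) = (\<integral>x. g x * f x \<partial>lborel)"
proof -
  have "integrable lborel (\<lambda>x. g (- x) * f (- x))"
    using int lborel_integrable_real_affine_iff[of "-1" "\<lambda>x. g x * f x" 0] by simp
  moreover have ae: "AE x in lborel. g (- x) * f (- x) = g (- x) * f x"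
    using f by eventually_elim simp
  ultimately show "integrable lborel (\<lambda>x. g (- x) * f x)"
    using integrable_cong_AE[OF _ _ ae] by simp
  have "(\<integral>x. g (- x) * f x \<partial>lborel) = (\<integral>x. g (- x) * f (- x) \<partial>lborel)"
    using ae by (intro integral_cong_AE) auto
  also have "\<dots> = (\<integral>x. g x * f x \<partial>lborel)"
    using lborel_integral_real_affine[of "-1" "\<lambda>x. g x * f x" 0] by simp
  finally show "(\<integral>x. g (- x) * f x \<partial>lborel) = (\<integral>x. g x * f x \<partial>lborel)" .
qed

text \<open>
  If \<open>\<bar>x\<bar> \<le> \<bar>y\<bar>\<close>, then \<open>x\<close> and \<open>- x\<close> are the convex combinations of \<open>y\<close> and \<open>- y\<close> with
  interchanged weights; adding the two concavity inequalities removes the weights.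
\<close>
lemma concave_symmetrization_antimono:
  fixes g :: "real \<Rightarrow> real"
  assumes g: "concave_on UNIV g" and xy: "\<bar>x\<bar> \<le> \<bar>y\<bar>"
  shows "g y + g (- y) \<le> g x + g (- x)"
proof (cases "y = 0")
  case False
  define p where "p = (1 + x / y) / 2"
  have "\<bar>x / y\<bar> \<le> 1"
    using xy False by (simp add: abs_divide)
  then have "- 1 \<le> x / y" "x / y \<le> 1"
    by linarith+
  then have p: "0 \<le> p" "p \<le> 1"
    unfolding p_def by auto
  have *: "(1 - p) * y + p * (- y) = - x" "(1 - p) * (- y) + p * y = x"
    using False unfolding p_def by (auto simp: field_simps)
  note concave_onD[OF g p, of y "- y"] concave_onD[OF g p, of "- y" y]
  then have "(1 - p) * g y + p * g (- y) \<le> g (- x)" "(1 - p) * g (- y) + p * g y \<le> g x"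
    unfolding real_scaleR_def * by simp_all
  then show ?thesis
    by (simp add: algebra_simps)
qed (use xy in simp)

text \<open>
  Since \<open>f\<^sub>2 - f\<^sub>1\<close> is even with integral 0, the integral of \<open>g (f\<^sub>2 - f\<^sub>1)\<close> does not change when \<open>g\<close>
  is symmetrized and a constant is subtracted.  Taking for the constant the value at the crossing point
  \<open>r\<close> makes both factors change sign at the same \<open>\<bar>x\<bar>\<close>, in opposite directions.  Integrability
  passes from \<open>f\<^sub>2\<close> to \<open>f\<^sub>1\<close> because \<open>f\<^sub>1 \<le> f\<^sub>2\<close> outside a bounded interval, on which \<open>g\<close> is bounded.
\<close>
lemma even_single_crossing_concave:
  fixes f1 f2 g :: "real \<Rightarrow> real"
  assumes g: "concave_on UNIV g" "continuous_on UNIV g"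
    and f_int: "integrable lborel f1" "integrable lborel f2"
    and f_eq: "(\<integral>x. f1 x \<partial>lborel) = (\<integral>x. f2 x \<partial>lborel)"
    and f_nonneg: "\<And>x. 0 \<le> f1 x"
    and f_even: "AE x in lborel. f1 (- x) = f1 x" "AE x in lborel. f2 (- x) = f2 x"
    and r: "0 \<le> r"
    and inner: "\<And>x. \<bar>x\<bar> < r \<Longrightarrow> f2 x \<le> f1 x" and outer: "\<And>x. r < \<bar>x\<bar> \<Longrightarrow> f1 x \<le> f2 x"
    and g_int: "integrable lborel (\<lambda>x. g x * f2 x)"
  shows "integrable lborel (\<lambda>x. g x * f1 x)"
    and "(\<integral>x. g x * f2 x \<partial>lborel) \<le> (\<integral>x. g x * f1 x \<partial>lborel)"
proof -
  have gm [measurable]: "g \<in> borel_measurable borel"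
    using g(2) by (rule borel_measurable_continuous_onI)
  have fm [measurable]: "f1 \<in> borel_measurable borel" "f2 \<in> borel_measurable borel"
    using f_int by auto
  have "bounded (g ` {-r..r})"
    using g(2)
    by (intro compact_imp_bounded compact_continuous_image) (auto intro: continuous_on_subset)
  then obtain B where B: "\<And>x. x \<in> {-r..r} \<Longrightarrow> \<bar>g x\<bar> \<le> B"
    unfolding bounded_iff by (metis image_eqI real_norm_def)
  show int1: "integrable lborel (\<lambda>x. g x * f1 x)"
  proof (rule Bochner_Integration.integrable_bound)
    show "integrable lborel (\<lambda>x. \<bar>B\<bar> * \<bar>f1 x\<bar> + \<bar>g x * f2 x\<bar>)"
      using f_int g_int by auto
    show "AE x in lborel. norm (g x * f1 x) \<le> norm (\<bar>B\<bar> * \<bar>f1 x\<bar> + \<bar>g x * f2 x\<bar>)"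
    proof (rule AE_I2)
      fix x
      show "norm (g x * f1 x) \<le> norm (\<bar>B\<bar> * \<bar>f1 x\<bar> + \<bar>g x * f2 x\<bar>)"
      proof (cases "\<bar>x\<bar> \<le> r")
        case True
        have "\<bar>g x\<bar> * \<bar>f1 x\<bar> \<le> \<bar>B\<bar> * \<bar>f1 x\<bar>"
          using True B[of x] abs_ge_self[of B] by (intro mult_right_mono) (auto simp: abs_le_iff)
        moreover have "0 \<le> \<bar>g x\<bar> * \<bar>f2 x\<bar>" by simp
        ultimately have "\<bar>g x\<bar> * \<bar>f1 x\<bar> \<le> \<bar>B\<bar> * \<bar>f1 x\<bar> + \<bar>g x\<bar> * \<bar>f2 x\<bar>" by linarith
        then show ?thesis by (simp add: abs_mult)
      next
        case False
        have "\<bar>g x\<bar> * \<bar>f1 x\<bar> \<le> \<bar>g x\<bar> * \<bar>f2 x\<bar>"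
          using False outer[of x] f_nonneg[of x] by (intro mult_left_mono) auto
        moreover have "0 \<le> \<bar>B\<bar> * \<bar>f1 x\<bar>" by simp
        ultimately have "\<bar>g x\<bar> * \<bar>f1 x\<bar> \<le> \<bar>B\<bar> * \<bar>f1 x\<bar> + \<bar>g x\<bar> * \<bar>f2 x\<bar>" by linarith
        then show ?thesis by (simp add: abs_mult)
      qed
    qed
  qed measurable
  define \<rho> where "\<rho> x = f2 x - f1 x" for x
  define k where "k x = g x + g (- x)" for x
  have g\<rho>: "integrable lborel (\<lambda>x. g x * \<rho> x)"
    unfolding \<rho>_def using int1 g_int by (simp add: right_diff_distrib)
  have \<rho>_even: "AE x in lborel. \<rho> (- x) = \<rho> x"
    using f_even unfolding \<rho>_def by eventually_elim simp
  have \<rho>m [measurable]: "\<rho> \<in> borel_measurable borel"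
    unfolding \<rho>_def[abs_def] by measurable
  note refl = integral_even_weight_reflect[OF \<rho>_even \<rho>m gm g\<rho>]
  have \<rho>: "integrable lborel \<rho>" "(\<integral>x. \<rho> x \<partial>lborel) = 0"
    using f_int f_eq unfolding \<rho>_def by auto
  have sign: "(k x - k r) * \<rho> x \<le> 0" for x
  proof (cases "\<bar>x\<bar>" r rule: linorder_cases)
    case less
    then have "k r \<le> k x"
      unfolding k_def by (intro concave_symmetrization_antimono[OF g(1)]) auto
    then show ?thesis
      using inner[OF less] unfolding \<rho>_def by (simp add: mult_nonneg_nonpos)
  next
    case equal
    then have "k x = k r" unfolding k_def by (auto simp: abs_if split: if_splits)
    then show ?thesis by simp
  next
    case greater
    then have "k x \<le> k r"
      unfolding k_def using r by (intro concave_symmetrization_antimono[OF g(1)]) auto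
    then show ?thesis
      using outer[OF greater] unfolding \<rho>_def by (simp add: mult_nonpos_nonneg)
  qed
  have "2 * (\<integral>x. g x * \<rho> x \<partial>lborel) = (\<integral>x. k x * \<rho> x \<partial>lborel)"
    using refl g\<rho> unfolding k_def by (simp add: distrib_right)
  also have "\<dots> = (\<integral>x. (k x - k r) * \<rho> x \<partial>lborel)"
    using refl g\<rho> \<rho> unfolding k_def by (simp add: left_diff_distrib distrib_right)
  also have "\<dots> \<le> 0"
    using Bochner_Integration.integral_nonneg[of lborel "\<lambda>x. - ((k x - k r) * \<rho> x)"] sign by simp
  finally show "(\<integral>x. g x * f2 x \<partial>lborel) \<le> (\<integral>x. g x * f1 x \<partial>lborel)"
    using int1 g_int unfolding \<rho>_def by (simp add: right_diff_distrib)
qed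

text \<open>
  The points of the positive half line where the quotient is at least 1 form an up-set, and \<open>r\<close> is its
  infimum.  If there were no such point, then \<open>p2 m \<le> p1 m\<close> with strict inequality wherever
  \<open>m \<noteq> 0\<close>, and the integrals could not both be 1.
\<close>
lemma monotone_ratio_single_crossing:
  fixes p1 p2 m :: "real \<Rightarrow> real"
  assumes pos: "\<And>x. 0 < p1 x" and even: "\<And>x. p1 (- x) = p1 x" "\<And>x. p2 (- x) = p2 x"
    and ratio: "\<And>x y. 0 \<le> x \<Longrightarrow> x \<le> y \<Longrightarrow> p2 x / p1 x \<le> p2 y / p1 y"
    and m: "\<And>x. 0 \<le> m x"
    and int: "integrable lborel (\<lambda>x. p1 x * m x)" "integrable lborel (\<lambda>x. p2 x * m x)"
    and eq: "(\<integral>x. p1 x * m x \<partial>lborel) = 1" "(\<integral>x. p2 x * m x \<partial>lborel) = 1"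
  obtains r where "0 \<le> r" "\<And>x. \<bar>x\<bar> < r \<Longrightarrow> p2 x * m x \<le> p1 x * m x"
    "\<And>x. r < \<bar>x\<bar> \<Longrightarrow> p1 x * m x \<le> p2 x * m x"
proof -
  define S where "S = {x. 0 \<le> x \<and> p1 x \<le> p2 x}"
  have abs: "p1 \<bar>x\<bar> = p1 x" "p2 \<bar>x\<bar> = p2 x" for x
    using even by (auto simp: abs_if)
  have "S \<noteq> {}"
  proof
    assume "S = {}"
    then have less: "p2 x < p1 x" for x
      using abs[of x] unfolding S_def by (metis (mono_tags, lifting) abs_ge_zero empty_Collect_eq not_le)
    have "(\<integral>x. p1 x * m x - p2 x * m x \<partial>lborel) = 0"
      using int eq by simp
    moreover have "AE x in lborel. 0 \<le> p1 x * m x - p2 x * m x"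
      using less m by (auto simp: less_imp_le mult_right_mono)
    ultimately have "AE x in lborel. p1 x * m x - p2 x * m x = 0"
      using int by (subst (asm) integral_nonneg_eq_0_iff_AE) auto
    then have "AE x in lborel. p1 x * m x = 0"
    proof eventually_elim
      case (elim x)
      then show ?case using less[of x] by (auto simp: algebra_simps)
    qed
    then have "(\<integral>x. p1 x * m x \<partial>lborel) = 0"
      by (rule integral_eq_zero_AE)
    with eq show False by simp
  qed
  have bdd: "bdd_below S"
    unfolding S_def by (rule bdd_belowI[of _ 0]) auto
  show thesis
  proof (rule that[of "Inf S"])
    show "0 \<le> Inf S"
      using \<open>S \<noteq> {}\<close> by (rule cInf_greatest) (auto simp: S_def)
    fix x
    show "p2 x * m x \<le> p1 x * m x" if "\<bar>x\<bar> < Inf S"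
    proof -
      have "\<bar>x\<bar> \<notin> S"
        using cInf_lower[OF _ bdd, of "\<bar>x\<bar>"] that by auto
      then show ?thesis
        using abs[of x] m[of x] unfolding S_def by (auto intro: mult_right_mono)
    qed
    show "p1 x * m x \<le> p2 x * m x" if x: "Inf S < \<bar>x\<bar>"
    proof -
      obtain y where y: "y \<in> S" "y < \<bar>x\<bar>"
        using cInf_less_iff[OF \<open>S \<noteq> {}\<close> bdd] x by auto
      have "1 \<le> p2 y / p1 y"
        using y(1) pos[of y] unfolding S_def by simp
      also have "\<dots> \<le> p2 x / p1 x"
        using ratio[of y "\<bar>x\<bar>"] y abs[of x] unfolding S_def by simp
      finally show ?thesis
        using pos[of x] m[of x] by (intro mult_right_mono) auto
    qed
  qed
qed

lemma (in prob_space) density_integral_1: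
  assumes "distributed M lborel Y (\<lambda>x. ennreal (f x))" and f: "\<And>x::real. 0 \<le> f x"
  shows "integrable lborel f" and "(\<integral>x. f x \<partial>lborel) = 1"
  using distributed_integrable[OF assms(1), of "\<lambda>_. 1"] distributed_integral[OF assms(1), of "\<lambda>_. 1"]
    f prob_space by auto

text \<open>
  The affine bound and the first moment make the positive part of \<open>g (Y2)\<close> integrable, so its
  expectation is either \<open>- \<infinity>\<close>, and there is nothing to prove, or an honest integral.
\<close>
lemma ext_expectation_single_crossing:
  fixes f1 f2 g Y1 Y2 :: "_ \<Rightarrow> real"
  assumes P: "prob_space P1" "prob_space P2"
    and Y: "distributed P1 lborel Y1 (\<lambda>x. ennreal (f1 x))" "distributed P2 lborel Y2 (\<lambda>x. ennreal (f2 x))"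
    and f_nonneg: "\<And>x. 0 \<le> f1 x" "\<And>x. 0 \<le> f2 x"
    and f_even: "AE x in lborel. f1 (- x) = f1 x" "AE x in lborel. f2 (- x) = f2 x"
    and r: "0 \<le> r" and inner: "\<And>x. \<bar>x\<bar> < r \<Longrightarrow> f2 x \<le> f1 x" and outer: "\<And>x. r < \<bar>x\<bar> \<Longrightarrow> f1 x \<le> f2 x"
    and moment: "integrable lborel (\<lambda>x. \<bar>x\<bar> * f2 x)"
    and g: "concave_on UNIV g" "continuous_on UNIV g" and affine: "\<And>x. g x \<le> a + c * x"
  shows "ext_expectation P2 (\<lambda>\<omega>. g (Y2 \<omega>)) \<le> ext_expectation P1 (\<lambda>\<omega>. g (Y1 \<omega>))"
proof -
  interpret P1: prob_space P1 by (rule P)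
  interpret P2: prob_space P2 by (rule P)
  have gm [measurable]: "g \<in> borel_measurable borel"
    using g(2) by (rule borel_measurable_continuous_onI)
  have Ym [measurable]: "Y2 \<in> borel_measurable P2" "Y1 \<in> borel_measurable P1"
    using distributed_measurable[OF Y(1)] distributed_measurable[OF Y(2)] by auto
  have "integrable P2 (\<lambda>\<omega>. \<bar>Y2 \<omega>\<bar>)"
    using distributed_integrable[OF Y(2), of "\<lambda>x. \<bar>x\<bar>"] moment f_nonneg by (simp add: mult.commute)
  then have "integrable P2 (\<lambda>\<omega>. \<bar>a\<bar> + \<bar>c\<bar> * \<bar>Y2 \<omega>\<bar>)"
    by auto
  then have "(\<integral>\<^sup>+\<omega>. ennreal (\<bar>a\<bar> + \<bar>c\<bar> * \<bar>Y2 \<omega>\<bar>) \<partial>P2) < \<infinity>"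
    by (simp add: real_integrable_def less_top)
  moreover have "(\<integral>\<^sup>+\<omega>. ennreal (g (Y2 \<omega>)) \<partial>P2) \<le> (\<integral>\<^sup>+\<omega>. ennreal (\<bar>a\<bar> + \<bar>c\<bar> * \<bar>Y2 \<omega>\<bar>) \<partial>P2)"
  proof (intro nn_integral_mono ennreal_leI)
    fix \<omega>
    have "c * Y2 \<omega> \<le> \<bar>c\<bar> * \<bar>Y2 \<omega>\<bar>"
      by (metis abs_ge_self abs_mult)
    then show "g (Y2 \<omega>) \<le> \<bar>a\<bar> + \<bar>c\<bar> * \<bar>Y2 \<omega>\<bar>"
      using affine[of "Y2 \<omega>"] abs_ge_self[of a] by linarith
  qed
  ultimately have fin: "(\<integral>\<^sup>+\<omega>. ennreal (g (Y2 \<omega>)) \<partial>P2) \<noteq> \<infinity>"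
    unfolding infinity_ennreal_def by (metis leD top.not_eq_extremum)
  show ?thesis
  proof (cases "(\<integral>\<^sup>+\<omega>. ennreal (- g (Y2 \<omega>)) \<partial>P2) = \<infinity>")
    case True
    obtain R where "(\<integral>\<^sup>+\<omega>. ennreal (g (Y2 \<omega>)) \<partial>P2) = ennreal R" "0 \<le> R"
      using fin by (metis ennreal_cases infinity_ennreal_def)
    then have "ext_expectation P2 (\<lambda>\<omega>. g (Y2 \<omega>)) = - \<infinity>"
      unfolding ext_expectation_def using True by (simp add: enn2ereal_ennreal)
    then show ?thesis by simp
  next
    case False
    then have int2: "integrable P2 (\<lambda>\<omega>. g (Y2 \<omega>))"
      using fin by (simp add: real_integrable_def)
    then have gf2: "integrable lborel (\<lambda>x. g x * f2 x)"
      using distributed_integrable[OF Y(2), of g] f_nonneg by (simp add: mult.commute)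
    note cross = even_single_crossing_concave[OF g
        P1.density_integral_1(1)[OF Y(1) f_nonneg(1)] P2.density_integral_1(1)[OF Y(2) f_nonneg(2)]
        _ f_nonneg(1) f_even r inner outer gf2]
    have eq: "(\<integral>x. f1 x \<partial>lborel) = (\<integral>x. f2 x \<partial>lborel)"
      using P1.density_integral_1(2)[OF Y(1) f_nonneg(1)] P2.density_integral_1(2)[OF Y(2) f_nonneg(2)]
      by simp
    have int1: "integrable P1 (\<lambda>\<omega>. g (Y1 \<omega>))"
      using distributed_integrable[OF Y(1), of g] cross(1)[OF eq] f_nonneg by (simp add: mult.commute)
    have "(\<integral>\<omega>. g (Y2 \<omega>) \<partial>P2) \<le> (\<integral>\<omega>. g (Y1 \<omega>) \<partial>P1)"
      using cross(2)[OF eq] distributed_integral[OF Y(1), of g] distributed_integral[OF Y(2), of g] f_nonneg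
      by (simp add: mult.commute)
    then show ?thesis
      using int1 int2 by (simp add: ext_expectation_eq_integral)
  qed
qed

section \<open>Comparison of the tilted processes\<close>

theorem lemma1:
  fixes M :: "'a measure" and F :: "real \<Rightarrow> 'a measure" and W :: "real \<Rightarrow> 'a \<Rightarrow> real"
    and T \<sigma> :: real and b :: "real \<Rightarrow> real"
    and X :: "real \<Rightarrow> real \<Rightarrow> real \<Rightarrow> 'a \<Rightarrow> real"
    and q :: "real \<Rightarrow> real \<Rightarrow> real \<Rightarrow> real \<Rightarrow> real"
    and h :: "real \<Rightarrow> real \<Rightarrow> real"
    and P :: "real \<Rightarrow> 'b measure" and Y :: "real \<Rightarrow> real \<Rightarrow> 'b \<Rightarrow> real"
    and indiff :: "real \<Rightarrow> real \<times> real \<Rightarrow> real \<times> real \<Rightarrow> bool"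
    and u :: "real \<Rightarrow> real \<Rightarrow> real"
    and l1 l2 t :: real
  assumes T: "0 < T"
    and b_regular: "C2_bounded_derivatives b"
    and b_odd: "\<And>x. b x = - b (- x)"
    and brownian: "brownian_motion_on M F T W"
    and base_diffusion: "\<And>s x0. s \<in> {0..T} \<Longrightarrow> sde_solution M F T b \<sigma> W s x0 (X s x0)"
    and q_density: "transition_density M T X q"
    and h_nonneg: "\<And>l x. 0 < l \<Longrightarrow> 0 \<le> h l x"
    and h_even: "\<And>l x. 0 < l \<Longrightarrow> h l (- x) = h l x"
    and h_0: "\<And>l. 0 < l \<Longrightarrow> 0 < h l 0"
    and h_param: "\<And>l x. 0 < l \<Longrightarrow> (\<lambda>k. h k x) differentiable (at l)"
    and h_space: "\<And>l. 0 < l \<Longrightarrow> twice_differentiable (h l)"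
    and h_eigen: "\<And>l x. 0 < l \<Longrightarrow> diffusion_operator b \<sigma> (h l) x = l * h l x"
    and h_martingale: "\<And>l. 0 < l \<Longrightarrow>
          martingale_on M F T (\<lambda>t \<omega>. exp (- l * t) * h l (X 0 0 t \<omega>) / h l 0)"
    and h_expectation: "\<And>l t. 0 < l \<Longrightarrow> t \<in> {0..T} \<Longrightarrow>
          (\<integral>\<omega>. exp (- l * t) * h l (X 0 0 t \<omega>) / h l 0 \<partial>M) = 1"
    and R_even: "\<And>l x. 0 < l \<Longrightarrow> deriv (\<lambda>k. h k x) l = deriv (\<lambda>k. h k (- x)) l"
    and R_nonneg: "\<And>l x. 0 < l \<Longrightarrow> 0 \<le> deriv (\<lambda>k. h k x) l"
    and family: "\<And>l. 0 < l \<Longrightarrow>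
          process_from_0_with_density (P l) T (Y l) (tilted_density h q l)"
    and l1: "0 < l1" and l12: "l1 < l2"
    and invariant: "time_invariant T indiff u"
    and consistent: "time_consistent T indiff u"
    and averse: "risk_averse T u"
    and t: "t \<in> {0..T}"
  shows "ext_expectation (P l1) (\<lambda>\<omega>. u (Y l1 t \<omega>) t)
       \<ge> ext_expectation (P l2) (\<lambda>\<omega>. u (Y l2 t \<omega>) t)"
proof -
  define k where "k = \<sigma>\<^sup>2 / 2"
  define c where "c l = exp (- l * t) / h l 0" for l
  obtain b' where b': "\<And>x. (b has_real_derivative b' x) (at x)" "bounded (range b')"
    using b_regular unfolding C2_bounded_derivatives_def by blast
  obtain L where L: "\<And>x. \<bar>b' x\<bar> \<le> L"
    using b'(2) unfolding bounded_iff by auto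
  have lip: "\<bar>b v - b w\<bar> \<le> L * \<bar>v - w\<bar>" for v w
    using field_differentiable_bound[of UNIV b b' L v w] b'(1) L by simp
  have b_cont: "continuous_on UNIV b"
    using b'(1) by (intro DERIV_continuous_on) (auto intro: has_field_derivative_at_within)
  have b_odd': "b (- x) = - b x" for x
    using b_odd[of x] by simp
  have b0: "b 0 = 0"
    using b_odd[of 0] by simp
  have b_linear: "\<bar>b x\<bar> \<le> L * \<bar>x\<bar>" for x
    using lip[of x 0] b0 by simp
  \<comment> \<open>For \<open>\<sigma> = 0\<close> the eigenvalue equation at 0, where the odd drift vanishes, would read \<open>0 = l1 * h l1 0\<close>.\<close>
  have "\<sigma> \<noteq> 0"
    using h_eigen[OF l1, of 0] h_0[OF l1] l1 b0 unfolding diffusion_operator_def by auto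
  then have k: "0 < k"
    unfolding k_def by simp
  have eigen: "even_eigenfunction k b l (h l) (deriv (h l)) (deriv (deriv (h l)))" if "0 < l" for l
    using h_space[OF that] h_eigen[OF that] h_even[OF that] h_nonneg[OF that] h_0[OF that] that
    unfolding even_eigenfunction_def twice_differentiable_def diffusion_operator_def k_def
    by (simp add: DERIV_deriv_iff_real_differentiable)
  have l2: "0 < l2" using l1 l12 by simp
  have P: "prob_space (P l)" if "0 < l" for l
    using family[OF that] unfolding process_from_0_with_density_def by simp
  show ?thesis
  proof (cases "t = 0")
    case True
    have "ext_expectation (P l) (\<lambda>\<omega>. u (Y l t \<omega>) t) = ereal (u 0 0)" if "0 < l" for l
    proof -
      interpret prob_space "P l" using P[OF that] .
      have "AE \<omega> in P l. Y l 0 \<omega> = 0"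
        using family[OF that] unfolding process_from_0_with_density_def by simp
      then have "ext_expectation (P l) (\<lambda>\<omega>. u (Y l t \<omega>) t) = ext_expectation (P l) (\<lambda>\<omega>. u 0 0)"
        unfolding ext_expectation_def True
        by (intro arg_cong2[where f = "(-)"] arg_cong[where f = enn2ereal] nn_integral_cong_AE) auto
      then show ?thesis
        by (simp add: ext_expectation_eq_integral prob_space)
    qed
    then show ?thesis using l1 l2 by simp
  next
    case False
    then have t0: "0 < t" "t \<le> T" using t by auto
    define m where "m x = q x t 0 0" for x
    have m: "0 \<le> m x" and X_density: "distributed M lborel (X 0 0 t) (\<lambda>x. ennreal (m x))" for x
      using q_density t0 unfolding transition_density_def m_def by auto
    interpret M: prob_space M
      using brownian unfolding brownian_motion_on_def by simp
    have m_even: "AE x in lborel. m (- x) = m x"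
    proof -
      have fm: "(\<lambda>x. ennreal (m x)) \<in> borel_measurable borel"
        using distributed_borel_measurable[OF X_density] by simp
      have "sde_solution M F T b \<sigma> W 0 0 (X 0 0)"
        using base_diffusion[of 0 0] T by simp
      then have "distr M borel (X 0 0 t) = distr M borel (\<lambda>\<omega>. - X 0 0 t \<omega>)"
        by (rule odd_drift_diffusion_symmetric[OF brownian _ lip b_cont b_odd' t0])
      then have "AE x in lborel. ennreal (m x) = ennreal (m (- x))"
        by (rule M.symmetric_law_even_density[OF X_density fm])
      then show ?thesis
        by eventually_elim (use m in simp)
    qed
    have tilt: "tilted_density h q l x t = c l * h l x * m x" for l x
      unfolding tilted_density_def c_def m_def by simp
    have c: "0 < c l" if "0 < l" for l
      unfolding c_def using h_0[OF that] by simp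
    have Y: "distributed (P l) lborel (Y l t) (\<lambda>x. ennreal (c l * h l x * m x))" if "0 < l" for l
    proof -
      have "distributed (P l) lborel (Y l t) (\<lambda>x. ennreal (tilted_density h q l x t))"
        using family[OF that] t0 unfolding process_from_0_with_density_def by simp
      then show ?thesis unfolding tilt .
    qed
    have f_nonneg: "0 \<le> c l * h l x * m x" if "0 < l" for l x
      using c[OF that] h_nonneg[OF that] m by (simp add: less_imp_le)
    have f_int: "integrable lborel (\<lambda>x. c l * h l x * m x)" "(\<integral>x. c l * h l x * m x \<partial>lborel) = 1"
      if "0 < l" for l
      using prob_space.density_integral_1[OF P[OF that] Y[OF that] f_nonneg[OF that]] by auto
    have f_even: "AE x in lborel. c l * h l (- x) * m (- x) = c l * h l x * m x" if "0 < l" for l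
      using m_even by eventually_elim (use h_even[OF that] in simp)
    have h_pos: "0 < h l x" if "0 < l" for l x
      using eigenfunction_increasing(2)[OF k b_cont b_linear eigen[OF that], of x]
        eigenfunction_increasing(2)[OF k b_cont b_linear eigen[OF that], of "- x"] h_even[OF that, of x]
      by (cases "0 \<le> x") auto
    obtain r where r: "0 \<le> r"
      "\<And>x. \<bar>x\<bar> < r \<Longrightarrow> c l2 * h l2 x * m x \<le> c l1 * h l1 x * m x"
      "\<And>x. r < \<bar>x\<bar> \<Longrightarrow> c l1 * h l1 x * m x \<le> c l2 * h l2 x * m x"
    proof (rule monotone_ratio_single_crossing[where m = m and ?p1.0 = "\<lambda>x. c l1 * h l1 x"
          and ?p2.0 = "\<lambda>x. c l2 * h l2 x"])
      show "c l2 * h l2 x / (c l1 * h l1 x) \<le> c l2 * h l2 y / (c l1 * h l1 y)"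
        if "0 \<le> x" "x \<le> y" for x y
      proof -
        have "h l2 x / h l1 x \<le> h l2 y / h l1 y"
          by (rule eigenfunction_ratio_nondecreasing[OF k b_cont b_linear eigen[OF l1] eigen[OF l2] _ that])
            (use l12 in simp)
        then have "(c l2 / c l1) * (h l2 x / h l1 x) \<le> (c l2 / c l1) * (h l2 y / h l1 y)"
          using c[OF l1] c[OF l2] by (intro mult_left_mono) auto
        then show ?thesis by simp
      qed
    qed (use c h_pos h_even l1 l2 m f_int in auto)
    \<comment> \<open>An eigenvalue large enough for \<open>h l3\<close> to dominate \<open>(1 + x\<^sup>2) h l2\<close>.\<close>
    define l3 where "l3 = l2 + 2 * k + 4 * k * (sqrt (l2 / k) + L / k) + 2 * L"
    have "0 \<le> L" using L[of 0] by linarith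
    then have l3: "0 < l3"
      unfolding l3_def using l2 k by (intro add_pos_nonneg) auto
    have mm: "(\<lambda>x. c l2 * h l2 x * m x) \<in> borel_measurable lborel"
      using f_int(1)[OF l2] by simp
    have moment: "integrable lborel (\<lambda>x. \<bar>x\<bar> * (c l2 * h l2 x * m x))"
    proof (rule Bochner_Integration.integrable_bound)
      define C where "C = c l2 * (h l2 0 / h l3 0) / c l3"
      show "integrable lborel (\<lambda>x. C * (c l3 * h l3 x * m x))"
        using f_int(1)[OF l3] by simp
      show "(\<lambda>x. \<bar>x\<bar> * (c l2 * h l2 x * m x)) \<in> borel_measurable lborel"
        using mm by simp
      show "AE x in lborel. norm (\<bar>x\<bar> * (c l2 * h l2 x * m x)) \<le> norm (C * (c l3 * h l3 x * m x))"
      proof (rule AE_I2)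
        fix x :: real
        have "\<bar>x\<bar> \<le> 1 + x\<^sup>2"
          using zero_le_power2[of "\<bar>x\<bar> - 1/2"] by (simp add: power2_eq_square algebra_simps)
        then have "\<bar>x\<bar> * h l2 x \<le> (1 + x\<^sup>2) * h l2 x"
          using h_nonneg[OF l2] by (rule mult_right_mono)
        also have "\<dots> \<le> h l2 0 / h l3 0 * h l3 x"
          by (rule eigenfunction_weighted_dominated[OF k b_cont b_linear eigen[OF l2] eigen[OF l3] l3_def])
        finally have "(c l2 * m x) * (\<bar>x\<bar> * h l2 x) \<le> (c l2 * m x) * (h l2 0 / h l3 0 * h l3 x)"
          using c[OF l2] m[of x] by (intro mult_left_mono) auto
        also have "\<dots> = C * (c l3 * h l3 x * m x)"
          unfolding C_def using c[OF l3] by simp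
        finally have "\<bar>x\<bar> * (c l2 * h l2 x * m x) \<le> C * (c l3 * h l3 x * m x)"
          by (simp add: ac_simps)
        moreover have "0 \<le> \<bar>x\<bar> * (c l2 * h l2 x * m x)"
          using f_nonneg[OF l2] by simp
        ultimately show "norm (\<bar>x\<bar> * (c l2 * h l2 x * m x)) \<le> norm (C * (c l3 * h l3 x * m x))"
          by simp
      qed
    qed
    define g where "g x = u x t" for x
    have g_deriv: "(g has_real_derivative deriv g x) (at x)"
      "(deriv g has_real_derivative deriv (deriv g) x) (at x)" "deriv (deriv g) x \<le> 0" for x
      using averse t unfolding risk_averse_def twice_differentiable_def g_def[abs_def]
      by (auto simp: DERIV_deriv_iff_real_differentiable)
    have g_concave: "concave_on UNIV g"
      using g_deriv by (intro f''_le0_imp_concave[where f' = "deriv g" and f'' = "deriv (deriv g)"]) auto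
    have g_cont: "continuous_on UNIV g"
      using g_deriv(1) by (intro DERIV_continuous_on) (auto intro: has_field_derivative_at_within)
    have affine: "g x \<le> g 0 + deriv g 0 * x" for x
      using convex_on_imp_above_tangent[of UNIV "\<lambda>x. - g x" 0 x "- deriv g 0"] g_concave
        DERIV_minus[OF g_deriv(1)[of 0]] unfolding concave_on_def by simp
    show ?thesis
      using ext_expectation_single_crossing[OF P[OF l1] P[OF l2] Y[OF l1] Y[OF l2]
          f_nonneg[OF l1] f_nonneg[OF l2] f_even[OF l1] f_even[OF l2] r moment g_concave g_cont affine]
      unfolding g_def .
  qed
qed

end
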